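(* (i) The class (II, III) of generalized triplets has $D_1$ even and not divisible by $3$ and $D_2=6d_2$ with $d_2$ a positive integer, and its triplets have the form $$p_i=3(2a-1)-D_1,\quad p_m=3(2a-1)+D_1=2b+1-6d_2,\quad p_f=2b+1+6d_2$$ with integers $a,b$, so that $$2b+1=3(2a-1)+D_1+6d_2,\qquad p_f=3(2a-1)+D_1+12d_2.$$ The prime pair consisting of $p_f=3(2a-1)+6d_2+(D_1+6d_2)$ and $p_i=3(2a-1)+6d_2-(D_1+6d_2)$ is in class II. (ii) If moreover $D_1\equiv 2r_1\pmod 6$ with $r_1\in\{1,-1\}$ and $a\equiv a_0\pmod 3$ with $a_0\in\{0,1,-1\}$, then $$p_i\equiv -3-2r_1,\quad p_m\equiv -3+2r_1\equiv 2b+1,\quad p_f\equiv p_m\pmod 6.$$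
   Context: A generalized triplet is a triple of odd primes $p_i<p_m<p_f$ with $p_m-p_i=2D_1$, $p_f-p_m=2D_2$. For a pair of odd primes $p<p'$ with $p'-p=2D$, the classes are, with $a$ an integer: class I: $D$ odd, $p=2a-D$, $p'=2a+D$; class II: $2\mid D$, $3\nmid D$, $p=3(2a-1)-D$, $p'=3(2a-1)+D$; class III: $6\mid D$, $D\ge 6$, $p=2a+1-D$, $p'=2a+1+D$. A triplet is in class $(X,Y)$ if $(p_i,p_m)$ is in class $X$ and $(p_m,p_f)$ is in class $Y$. *)

theory Defs
  imports "HOL-Number_Theory.Number_Theory"
begin

text \<open>
  Primes are taken in \<^typ>\<open>int\<close> so that the differences and the (possibly nonpositive) class
  parameter \<open>a\<close> need no coercions; \<^term>\<open>prime p\<close> forces \<open>p > 0\<close> there.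
\<close>

definition odd_prime_pair :: "int \<Rightarrow> int \<Rightarrow> int \<Rightarrow> bool" where
  "odd_prime_pair p p' D \<longleftrightarrow>
     prime p \<and> odd p \<and> prime p' \<and> odd p' \<and> p < p' \<and> p' - p = 2 * D"

definition generalized_triplet :: "int \<Rightarrow> int \<Rightarrow> int \<Rightarrow> int \<Rightarrow> int \<Rightarrow> bool" where
  "generalized_triplet p_i p_m p_f D1 D2 \<longleftrightarrow>
     odd_prime_pair p_i p_m D1 \<and> odd_prime_pair p_m p_f D2"

datatype pair_class = ClassI | ClassII | ClassIII

fun class_condition :: "pair_class \<Rightarrow> int \<Rightarrow> int \<Rightarrow> int \<Rightarrow> bool" where
  "class_condition ClassI p p' D \<longleftrightarrow>
     odd D \<and> (\<exists>a::int. p = 2 * a - D \<and> p' = 2 * a + D)"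
| "class_condition ClassII p p' D \<longleftrightarrow>
     2 dvd D \<and> \<not> 3 dvd D \<and> (\<exists>a::int. p = 3 * (2 * a - 1) - D \<and> p' = 3 * (2 * a - 1) + D)"
| "class_condition ClassIII p p' D \<longleftrightarrow>
     6 dvd D \<and> D \<ge> 6 \<and> (\<exists>a::int. p = 2 * a + 1 - D \<and> p' = 2 * a + 1 + D)"

definition pair_in_class :: "pair_class \<Rightarrow> int \<Rightarrow> int \<Rightarrow> bool" where
  "pair_in_class X p p' \<longleftrightarrow> (\<exists>D. odd_prime_pair p p' D \<and> class_condition X p p' D)"

definition triplet_in_class :: "pair_class \<Rightarrow> pair_class \<Rightarrow> int \<Rightarrow> int \<Rightarrow> int \<Rightarrow> bool" where
  "triplet_in_class X Y p_i p_m p_f \<longleftrightarrow> pair_in_class X p_i p_m \<and> pair_in_class Y p_m p_f"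

end

theory Submission
  imports Defs
begin

text \<open>Everything rests on shifting by multiples of 6. Half the difference of a pair is fixed
  by its endpoints, so the class conditions apply to \<open>D1\<close> and \<open>D2\<close>
  themselves and supply the parameters. Equating the two expressions for \<open>p_m\<close> gives
  \<open>2 * b + 1\<close>, hence \<open>p_f\<close>. The outer pair then has half-difference
  \<open>D1 + 6 * d2\<close> and centre \<open>3 * (2 * a - 1) + 6 * d2\<close>: both are the data
  of the class II pair \<open>(p_i, p_m)\<close> moved by \<open>6 * d2\<close>, which preserves the
  class II condition. The residues modulo 6 follow by dropping multiples of 6.\<close>

theorem corollary2p9:
  fixes p_i p_m p_f D1 D2 :: int
  assumes "generalized_triplet p_i p_m p_f D1 D2"
    and "triplet_in_class ClassII ClassIII p_i p_m p_f"
  shows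
    "(even D1 \<and> \<not> 3 dvd D1 \<and>
      (\<exists>d2 a b :: int. d2 > 0 \<and> D2 = 6 * d2 \<and>
         p_i = 3 * (2 * a - 1) - D1 \<and>
         p_m = 3 * (2 * a - 1) + D1 \<and> p_m = 2 * b + 1 - 6 * d2 \<and>
         p_f = 2 * b + 1 + 6 * d2)) \<and>
     (\<forall>d2 a b :: int.
        d2 > 0 \<and> D2 = 6 * d2 \<and>
        p_i = 3 * (2 * a - 1) - D1 \<and>
        p_m = 3 * (2 * a - 1) + D1 \<and> p_m = 2 * b + 1 - 6 * d2 \<and>
        p_f = 2 * b + 1 + 6 * d2 \<longrightarrow>
          (2 * b + 1 = 3 * (2 * a - 1) + D1 + 6 * d2 \<and>
           p_f = 3 * (2 * a - 1) + D1 + 12 * d2 \<and>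
           p_f = 3 * (2 * a - 1) + 6 * d2 + (D1 + 6 * d2) \<and>
           p_i = 3 * (2 * a - 1) + 6 * d2 - (D1 + 6 * d2) \<and>
           pair_in_class ClassII p_i p_f) \<and>
          (\<forall>r1 a0 :: int.
             r1 \<in> {1, -1} \<and> [D1 = 2 * r1] (mod 6) \<and>
             a0 \<in> {0, 1, -1} \<and> [a = a0] (mod 3) \<longrightarrow>
               [p_i = -3 - 2 * r1] (mod 6) \<and>
               [p_m = -3 + 2 * r1] (mod 6) \<and>
               [-3 + 2 * r1 = 2 * b + 1] (mod 6) \<and>
               [p_f = p_m] (mod 6)))"
proof (intro conjI allI impI)
  have pairs: "odd_prime_pair p_i p_m D1" "odd_prime_pair p_m p_f D2"
    using assms(1) by (simp_all add: generalized_triplet_def)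
  obtain D D' where "odd_prime_pair p_i p_m D" "class_condition ClassII p_i p_m D"
      "odd_prime_pair p_m p_f D'" "class_condition ClassIII p_m p_f D'"
    using assms(2) by (auto simp: triplet_in_class_def pair_in_class_def)
  \<comment> \<open>The existential half-differences in \<open>pair_in_class\<close> are forced,
    since \<open>2 * D\<close> is the difference of the endpoints.\<close>
  moreover from this pairs have "D = D1" "D' = D2"
    by (auto simp: odd_prime_pair_def)
  ultimately have classes: "class_condition ClassII p_i p_m D1" "class_condition ClassIII p_m p_f D2"
    by simp_all
  from classes(1) show D1: "even D1" "\<not> 3 dvd D1" by simp_all
  obtain a where "p_i = 3 * (2 * a - 1) - D1" "p_m = 3 * (2 * a - 1) + D1"
    using classes(1) by auto
  \<comment> \<open>Positivity of \<open>d2\<close> comes from the bound \<open>D2 \<ge> 6\<close>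
    in class III.\<close>
  moreover obtain b d2 where "D2 = 6 * d2" "d2 > 0" "p_m = 2 * b + 1 - 6 * d2" "p_f = 2 * b + 1 + 6 * d2"
    using classes(2) by (auto elim!: dvdE)
  ultimately show "\<exists>d2 a b :: int. d2 > 0 \<and> D2 = 6 * d2 \<and>
         p_i = 3 * (2 * a - 1) - D1 \<and>
         p_m = 3 * (2 * a - 1) + D1 \<and> p_m = 2 * b + 1 - 6 * d2 \<and>
         p_f = 2 * b + 1 + 6 * d2"
    by blast
  fix d2 a b :: int
  assume form: "d2 > 0 \<and> D2 = 6 * d2 \<and>
        p_i = 3 * (2 * a - 1) - D1 \<and>
        p_m = 3 * (2 * a - 1) + D1 \<and> p_m = 2 * b + 1 - 6 * d2 \<and>
        p_f = 2 * b + 1 + 6 * d2"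
  then show b: "2 * b + 1 = 3 * (2 * a - 1) + D1 + 6 * d2"
    and "p_f = 3 * (2 * a - 1) + D1 + 12 * d2"
    and pf: "p_f = 3 * (2 * a - 1) + 6 * d2 + (D1 + 6 * d2)"
    and pi: "p_i = 3 * (2 * a - 1) + 6 * d2 - (D1 + 6 * d2)"
    by linarith+
  have "odd_prime_pair p_i p_f (D1 + 6 * d2)"
    using pairs pf pi by (auto simp: odd_prime_pair_def)
  \<comment> \<open>The shift \<open>6 * d2\<close> of the centre is absorbed by taking
    \<open>a + d2\<close> as the class II parameter.\<close>
  moreover have "p_i = 3 * (2 * (a + d2) - 1) - (D1 + 6 * d2)"
      "p_f = 3 * (2 * (a + d2) - 1) + (D1 + 6 * d2)"
    unfolding pf pi by (simp_all add: algebra_simps)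
  moreover have "even (D1 + 6 * d2)" "\<not> 3 dvd D1 + 6 * d2"
    using D1 by presburger+
  ultimately show "pair_in_class ClassII p_i p_f"
    unfolding pair_in_class_def class_condition.simps by blast
  fix r1 a0 :: int
  assume "r1 \<in> {1, -1} \<and> [D1 = 2 * r1] (mod 6) \<and>
             a0 \<in> {0, 1, -1} \<and> [a = a0] (mod 3)"
  \<comment> \<open>With the quotient \<open>k\<close> explicit, each congruence becomes
    divisibility by 6 of a linear term: \<open>p_i\<close> and \<open>p_m\<close> are
    \<open>6 * a - 3\<close> minus or plus \<open>D1\<close>, while \<open>2 * b + 1\<close> and
    \<open>p_f\<close> exceed \<open>p_m\<close> by \<open>6 * d2\<close> and
    \<open>12 * d2\<close>.\<close>
  then obtain k where k: "D1 = 2 * r1 + 6 * k"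
    by (metis cong_iff_lin cong_sym)
  show "[p_i = -3 - 2 * r1] (mod 6)" "[p_m = -3 + 2 * r1] (mod 6)"
      "[-3 + 2 * r1 = 2 * b + 1] (mod 6)" "[p_f = p_m] (mod 6)"
    using form k b unfolding cong_iff_dvd_diff by presburger+
qed

end
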